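(* Let $f:[a,b]\to\mathbb{R}$ be a nonnegative and convex function. Then one has the inequality $$\frac{1}{b-a}\int_a^b f(x)\,dx\le \frac12 f\left(\frac{a+b}{2}\right)+\frac{1}{4f\left(\frac{a+b}{2}\right)(b-a)}\int_a^b f^2(x)\,dx+\frac{N(a,b)}{24f\left(\frac{a+b}{2}\right)},$$ where $N(a,b)=f^2(a)+4f(a)f(b)+f^2(b)$.
   Context: Here $[a,b]$ is an interval of real numbers and $f^2(x)$ denotes $(f(x))^2$. *)

theory Defs
  imports "HOL-Analysis.Analysis"
begin

end

theory Submission
  imports Defs
begin

text \<open>
  Write \<open>m = f ((a + b) / 2) > 0\<close> and let \<open>g x = f (a + b - x)\<close> be the reflection of \<open>f\<close> in the
  midpoint. From \<open>0 \<le> ((f x + g x) / 2 - m)\<^sup>2\<close> one gets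
  \<open>m (f x + g x) / 2 \<le> m\<^sup>2 / 2 + ((f x)\<^sup>2 + (g x)\<^sup>2) / 8 + f x * g x / 4\<close>.
  Reflection preserves integrals (\<open>has_integral_reflect_interval\<close>), so taking mean values over
  \<open>[a, b]\<close> bounds \<open>m\<close> times the mean of \<open>f\<close> by \<open>m\<^sup>2 / 2\<close>, a quarter of the mean of \<open>f\<^sup>2\<close> and a
  quarter of the mean of \<open>f g\<close>. Convexity places the nonnegative functions \<open>f\<close> and \<open>g\<close> below their
  chords, and the product of the two chords has mean \<open>N(a, b) / 6\<close>
  (\<open>has_integral_chord_product\<close>). Dividing by \<open>m\<close> gives the theorem.

  A convex function may jump at the endpoints, so integrability comes from continuity on the open
  interval together with boundedness (\<open>integrable_on_continuous_interior_bounded\<close>).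
\<close>

lemma integrable_on_continuous_interior_bounded:
  fixes h :: "real \<Rightarrow> real"
  assumes "continuous_on {a<..<b} h" and "\<And>x. x \<in> {a<..<b} \<Longrightarrow> \<bar>h x\<bar> \<le> B"
  shows "h integrable_on {a..b}"
proof -
  have "h integrable_on {a<..<b}"
  proof (rule measurable_bounded_by_integrable_imp_integrable)
    show "h \<in> borel_measurable (lebesgue_on {a<..<b})"
      by (rule continuous_imp_measurable_on_sets_lebesgue) (use assms(1) in auto)
    show "(\<lambda>_. B) integrable_on {a<..<b}"
      unfolding integrable_on_open_interval_real by (rule integrable_const_ivl)
  qed (use assms(2) in auto)
  then show ?thesis
    by (simp add: integrable_on_open_interval_real)
qed

lemma has_integral_reflect_interval:
  fixes h :: "real \<Rightarrow> real"
  assumes "(h has_integral I) {a..b}" and "a \<le> b"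
  shows "((\<lambda>x. h (a + b - x)) has_integral I) {a..b}"
proof -
  have img: "(\<lambda>x. a + b - x) ` {a..b} = {a..b}"
    using \<open>a \<le> b\<close> by (auto simp: image_iff intro!: bexI[of _ "a + b - _"])
  show ?thesis
    using has_integral_affinity[of h I a b "-1" "a + b"] assms img
    by (simp add: algebra_simps)
qed

lemma convex_on_le_chord:
  fixes f :: "real \<Rightarrow> real"
  assumes "convex_on {a..b} f" "a < b" "x \<in> {a..b}"
  shows "f x \<le> (f a * (b - x) + f b * (x - a)) / (b - a)"
proof -
  have "f ((1 - (x - a) / (b - a)) *\<^sub>R a + ((x - a) / (b - a)) *\<^sub>R b)
      \<le> (1 - (x - a) / (b - a)) * f a + ((x - a) / (b - a)) * f b"
    by (rule convex_onD[OF assms(1)]) (use assms in \<open>auto simp: field_simps\<close>)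
  moreover have "(1 - (x - a) / (b - a)) *\<^sub>R a + ((x - a) / (b - a)) *\<^sub>R b = x"
    using assms by (simp add: divide_simps) algebra
  moreover have "(1 - (x - a) / (b - a)) * f a + ((x - a) / (b - a)) * f b
      = (f a * (b - x) + f b * (x - a)) / (b - a)"
  proof -
    have "1 - (x - a) / (b - a) = (b - x) / (b - a)"
      using assms(2) by (simp add: field_simps)
    then show ?thesis by (simp add: add_divide_distrib mult.commute)
  qed
  ultimately show ?thesis by simp
qed

lemma has_integral_chord_product:
  fixes a b A B :: real
  assumes "a < b"
  shows "((\<lambda>x. (A * (b - x) + B * (x - a)) / (b - a) * ((A * (x - a) + B * (b - x)) / (b - a)))
    has_integral (b - a) * ((A\<^sup>2 + 4 * A * B + B\<^sup>2) / 6)) {a..b}"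
proof -
  define c where "c = b - a"
  have c: "c > 0" and b: "b = a + c" using assms by (auto simp: c_def)
  define F where "F x = (A * B * ((x - a) ^ 3 - (b - x) ^ 3) / 3
    + (A\<^sup>2 + B\<^sup>2) * (c * (x - a)\<^sup>2 / 2 - (x - a) ^ 3 / 3)) / c\<^sup>2" for x
  have "((\<lambda>x. (A * B * ((x - a)\<^sup>2 + (b - x)\<^sup>2) + (A\<^sup>2 + B\<^sup>2) * (c * (x - a) - (x - a)\<^sup>2)) / c\<^sup>2)
      has_integral F b - F a) {a..b}"
  proof (rule fundamental_theorem_of_calculus)
    fix x
    show "(F has_vector_derivative
        (A * B * ((x - a)\<^sup>2 + (b - x)\<^sup>2) + (A\<^sup>2 + B\<^sup>2) * (c * (x - a) - (x - a)\<^sup>2)) / c\<^sup>2)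
        (at x within {a..b})"
      unfolding F_def has_real_derivative_iff_has_vector_derivative[symmetric]
      using c by (auto intro!: derivative_eq_intros simp: field_simps power2_eq_square)
  qed (use assms in simp)
  moreover have "F b - F a = (b - a) * ((A\<^sup>2 + 4 * A * B + B\<^sup>2) / 6)"
    using c unfolding F_def b by (simp add: field_simps power2_eq_square power3_eq_cube)
  moreover have "(A * B * ((x - a)\<^sup>2 + (b - x)\<^sup>2) + (A\<^sup>2 + B\<^sup>2) * (c * (x - a) - (x - a)\<^sup>2)) / c\<^sup>2
      = (A * (b - x) + B * (x - a)) / (b - a) * ((A * (x - a) + B * (b - x)) / (b - a))" for x
    unfolding c_def by (simp add: power2_eq_square) (simp add: algebra_simps)
  ultimately show ?thesis by simp
qed

theorem mainTheorem2:
  fixes f :: "real \<Rightarrow> real" and a b :: real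
  assumes "a < b"
    and "\<And>x. x \<in> {a..b} \<Longrightarrow> 0 \<le> f x"
    and "convex_on {a..b} f"
    and "f ((a + b) / 2) \<noteq> 0"
  shows "1 / (b - a) * integral {a..b} f
    \<le> 1 / 2 * f ((a + b) / 2)
      + 1 / (4 * f ((a + b) / 2) * (b - a)) * integral {a..b} (\<lambda>x. (f x)\<^sup>2)
      + ((f a)\<^sup>2 + 4 * f a * f b + (f b)\<^sup>2) / (24 * f ((a + b) / 2))"
proof -
  define m where "m = f ((a + b) / 2)"
  define c where "c = b - a"
  define g where "g x = f (a + b - x)" for x
  define N where "N = (f a)\<^sup>2 + 4 * f a * f b + (f b)\<^sup>2"
  define L where "L x = (f a * (b - x) + f b * (x - a)) / (b - a)" for x
  have m: "m > 0"
    using assms(2)[of "(a + b) / 2"] assms(1,4) by (simp add: m_def)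
  have c: "c > 0" using assms(1) by (simp add: c_def)
  have f_le: "f x \<le> L x" if "x \<in> {a..b}" for x
    using convex_on_le_chord[OF assms(3,1) that] by (simp add: L_def)
  have bound: "f x \<le> f a + f b" if "x \<in> {a..b}" for x
  proof -
    have "f a * (b - x) \<le> f a * (b - a)" "f b * (x - a) \<le> f b * (b - a)"
      using assms(1,2) that by (auto intro!: mult_left_mono)
    then have "L x \<le> f a + f b"
      using assms(1) by (simp add: L_def divide_simps algebra_simps)
    with f_le[OF that] show ?thesis by linarith
  qed
  have g_nonneg: "0 \<le> g x" and g_le: "g x \<le> L (a + b - x)" and g_bound: "g x \<le> f a + f b"
    if "x \<in> {a..b}" for x
    using assms(2)[of "a + b - x"] f_le[of "a + b - x"] bound[of "a + b - x"] that
    by (auto simp: g_def)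

  have cont: "continuous_on {a<..<b} f"
    by (rule convex_on_continuous)
       (auto intro: convex_on_subset[OF assms(3)] simp: greaterThanLessThan_subseteq_atLeastAtMost_iff)
  have cont_g: "continuous_on {a<..<b} g"
    unfolding g_def
    by (rule continuous_on_compose2[OF cont]) (auto intro!: continuous_intros)
  have int_f: "f integrable_on {a..b}"
    by (rule integrable_on_continuous_interior_bounded[OF cont, of "f a + f b"])
       (use assms(2) bound in auto)
  have int_f2: "(\<lambda>x. (f x)\<^sup>2) integrable_on {a..b}"
    by (rule integrable_on_continuous_interior_bounded[of _ _ _ "(f a + f b)\<^sup>2"])
       (use assms(2) bound in \<open>auto intro!: continuous_intros cont power_mono\<close>)
  have int_fg: "(\<lambda>x. f x * g x) integrable_on {a..b}"
    by (rule integrable_on_continuous_interior_bounded[of _ _ _ "(f a + f b) * (f a + f b)"])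
       (use assms(1,2) bound g_nonneg g_bound in
         \<open>auto intro!: continuous_intros cont cont_g mult_mono add_nonneg_nonneg simp: abs_mult\<close>)

  define I where "I = integral {a..b} f"
  define J where "J = integral {a..b} (\<lambda>x. (f x)\<^sup>2)"
  define K where "K = integral {a..b} (\<lambda>x. f x * g x)"
  have I: "(f has_integral I) {a..b}" and J: "((\<lambda>x. (f x)\<^sup>2) has_integral J) {a..b}"
    and K: "((\<lambda>x. f x * g x) has_integral K) {a..b}"
    using int_f int_f2 int_fg by (auto simp: I_def J_def K_def)
  have Ig: "(g has_integral I) {a..b}" and Jg: "((\<lambda>x. (g x)\<^sup>2) has_integral J) {a..b}"
    using has_integral_reflect_interval[OF I] has_integral_reflect_interval[OF J] assms(1)
    by (simp_all add: g_def[abs_def])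

  have "K \<le> c * (N / 6)"
  proof (rule has_integral_le[OF K])
    show "((\<lambda>x. L x * L (a + b - x)) has_integral c * (N / 6)) {a..b}"
      using has_integral_chord_product[OF assms(1), of "f a" "f b"]
      by (simp add: L_def c_def N_def algebra_simps)
    fix x assume x: "x \<in> {a..b}"
    show "f x * g x \<le> L x * L (a + b - x)"
      by (rule mult_mono[OF f_le[OF x] g_le[OF x] _ g_nonneg[OF x]])
         (use assms(2)[OF x] f_le[OF x] in linarith)
  qed
  moreover have "m / 2 * (I + I) \<le> c * (m\<^sup>2 / 2) + (1 / 8 * (J + J) + 1 / 4 * K)"
  proof (rule has_integral_le)
    show "((\<lambda>x. m / 2 * (f x + g x)) has_integral m / 2 * (I + I)) {a..b}"
      by (intro has_integral_mult_right has_integral_add I Ig)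
    show "((\<lambda>x. m\<^sup>2 / 2 + (1 / 8 * ((f x)\<^sup>2 + (g x)\<^sup>2) + 1 / 4 * (f x * g x)))
        has_integral c * (m\<^sup>2 / 2) + (1 / 8 * (J + J) + 1 / 4 * K)) {a..b}"
      using has_integral_const_real[of "m\<^sup>2 / 2" a b] assms(1)
      by (intro has_integral_mult_right has_integral_add J Jg K) (simp add: c_def)
    fix x
    have "0 \<le> ((f x + g x) / 2 - m)\<^sup>2" by simp
    then show "m / 2 * (f x + g x)
        \<le> m\<^sup>2 / 2 + (1 / 8 * ((f x)\<^sup>2 + (g x)\<^sup>2) + 1 / 4 * (f x * g x))"
      by (simp add: power2_eq_square field_simps)
  qed
  ultimately have "m * I \<le> c * m\<^sup>2 / 2 + J / 4 + c * N / 24"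
    by (simp add: field_simps)
  then have "m * I / (m * c) \<le> (c * m\<^sup>2 / 2 + J / 4 + c * N / 24) / (m * c)"
    using m c by (intro divide_right_mono) auto
  also have "m * I / (m * c) = 1 / c * I"
    using m by simp
  also have "(c * m\<^sup>2 / 2 + J / 4 + c * N / 24) / (m * c)
      = 1 / 2 * m + 1 / (4 * m * c) * J + N / (24 * m)"
    using m c by (simp add: field_simps power2_eq_square)
  finally show ?thesis
    by (simp add: m_def c_def I_def J_def N_def)
qed

end
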